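(* Let $$A=\begin{pmatrix} a & b \\ b & c\end{pmatrix}$$ be an integer doubly nonnegative matrix. Then $A$ has an integer cp-factorization, and the integer cp-rank of $A$ is less than or equal to $11$.
   Context: A real symmetric matrix is doubly nonnegative if it is entrywise nonnegative and positive semidefinite; an integer doubly nonnegative matrix is a doubly nonnegative matrix all of whose entries are integers. An integer cp-factorization of an $n\times n$ matrix $A$ is a factorization $A=VV^T$ where $V$ is an $n\times m$ matrix (for some $m$, not necessarily equal to $n$) all of whose entries are nonnegative integers. The integer cp-rank of $A$ is the minimal number $m$ of columns of $V$ over all integer cp-factorizations $A=VV^T$. *)

theory Defs
  imports Complex_Main "Jordan_Normal_Form.Matrix"
begin

definition symmetric_mat :: "real mat \<Rightarrow> bool" where
  "symmetric_mat A \<longleftrightarrow> square_mat A \<and> transpose_mat A = A"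

definition positive_semidefinite :: "real mat \<Rightarrow> bool" where
  "positive_semidefinite A \<longleftrightarrow>
     symmetric_mat A \<and> (\<forall>x \<in> carrier_vec (dim_row A). 0 \<le> x \<bullet> (A *\<^sub>v x))"

definition doubly_nonnegative :: "real mat \<Rightarrow> bool" where
  "doubly_nonnegative A \<longleftrightarrow>
     symmetric_mat A \<and> (\<forall>e \<in> elements_mat A. 0 \<le> e) \<and> positive_semidefinite A"

definition integer_doubly_nonnegative :: "real mat \<Rightarrow> bool" where
  "integer_doubly_nonnegative A \<longleftrightarrow> doubly_nonnegative A \<and> elements_mat A \<subseteq> \<int>"

text \<open>The set \<open>\<nat>\<close> is that of the nonnegative integers within the reals.
  The number of columns of \<open>V\<close> is unconstrained, and may be 0 (then \<open>A\<close> is a zero matrix).\<close>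

definition integer_cp_factorization :: "real mat \<Rightarrow> real mat \<Rightarrow> bool" where
  "integer_cp_factorization A V \<longleftrightarrow>
     dim_row V = dim_row A \<and> elements_mat V \<subseteq> \<nat> \<and> A = V * transpose_mat V"

definition has_integer_cp_factorization :: "real mat \<Rightarrow> bool" where
  "has_integer_cp_factorization A \<longleftrightarrow> (\<exists>V. integer_cp_factorization A V)"

text \<open>Only meaningful if \<open>has_integer_cp_factorization A\<close> holds: otherwise
  \<open>LEAST\<close> ranges over the empty set and its value is unspecified.\<close>

definition integer_cp_rank :: "real mat \<Rightarrow> nat" where
  "integer_cp_rank A = (LEAST m. \<exists>V. integer_cp_factorization A V \<and> dim_col V = m)"

end

theory Submission
  imports Defs "HOL-Computational_Algebra.Primes" "HOL-Library.Discrete_Functions"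
begin

text \<open>
  Replacing the Gram vectors \<open>x, y\<close> by \<open>x, y - x\<close> (or \<open>x - y, y\<close>) preserves the determinant and
  reduces to \<open>b \<le> a\<close> and \<open>b \<le> c\<close>. Splitting \<open>b\<close>, \<open>a - b\<close> and \<open>c - b\<close> into four squares each would
  then give 12 columns. To save one, write \<open>d = min b (a - b)\<close> as \<open>s \<bullet> t\<close> with \<open>s, t \<in> \<nat>\<^sup>3\<close>, \<open>t \<le> s\<close>
  and \<open>\<bar>s\<bar>\<^sup>2 \<le> 2 d \<le> a\<close>, and let \<open>w, v \<in> \<nat>\<^sup>4\<close> be given by Lagrange's theorem: take \<open>x = (s, w, 0)\<close>
  and \<open>y = (t, 0, v)\<close> if \<open>d = b\<close>, but \<open>y = (s - t, w, v)\<close> if \<open>d = a - b\<close>. Since \<open>0 \<le> t \<le> s\<close>, the part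
  of \<open>y\<close> other than \<open>v\<close> has squared norm at most \<open>b \<le> c\<close>, which leaves room for \<open>v\<close>.
\<close>

section \<open>Lagrange's four-square theorem\<close>

definition sum_of_four_squares :: "int \<Rightarrow> bool" where
  "sum_of_four_squares n \<longleftrightarrow> (\<exists>w x y z. n = w\<^sup>2 + x\<^sup>2 + y\<^sup>2 + z\<^sup>2)"

text \<open>Multiplicativity of the quaternion norm, for w + xi + yj + zk times the conjugate of a +
  bi + cj + dk. Because of the conjugate, the last three terms vanish when both quadruples agree,
  which the descent exploits.\<close>

lemma euler_four_square_identity:
  fixes a b c d w x y z :: "'a::comm_ring_1"
  shows "(a\<^sup>2 + b\<^sup>2 + c\<^sup>2 + d\<^sup>2) * (w\<^sup>2 + x\<^sup>2 + y\<^sup>2 + z\<^sup>2) =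
    (a*w + b*x + c*y + d*z)\<^sup>2 + (a*x - b*w + c*z - d*y)\<^sup>2 +
    (a*y - c*w + d*x - b*z)\<^sup>2 + (a*z - d*w + b*y - c*x)\<^sup>2"
  by (simp add: power2_eq_square algebra_simps)

lemma sum_of_four_squares_mult:
  "sum_of_four_squares m \<Longrightarrow> sum_of_four_squares n \<Longrightarrow> sum_of_four_squares (m * n)"
  unfolding sum_of_four_squares_def by (metis euler_four_square_identity)

lemma centered_residue:
  fixes x m :: int
  assumes "0 < m"
  obtains a k where "x = a + m * k" "2 * \<bar>a\<bar> \<le> m"
proof (cases "2 * (x mod m) \<le> m")
  case True
  then show ?thesis using that[of "x mod m" "x div m"] assms by simp
next
  case False
  moreover have "x = (x mod m - m) + m * (x div m + 1)" by (simp add: algebra_simps)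
  moreover have "x mod m < m" using assms by simp
  ultimately show ?thesis using that[of "x mod m - m" "x div m + 1"] by simp
qed

text \<open>Pigeonhole: for \<open>x\<close> and \<open>y\<close> from 0 to
  \<open>(p - 1) div 2\<close>, the residues of \<open>x\<^sup>2\<close> and of
  \<open>- 1 - y\<^sup>2\<close> take \<open>(p + 1) div 2\<close> values each, too many to be
  disjoint modulo \<open>p\<close>. The bounds on \<open>x\<close> and \<open>y\<close> will keep
  the cofactor of \<open>p\<close> below \<open>p\<close>.\<close>

lemma prime_dvd_sum_two_squares_plus_one:
  fixes p :: int
  assumes "prime p" "odd p"
  obtains x y where "p dvd x\<^sup>2 + y\<^sup>2 + 1" "0 \<le> x" "2 * x < p" "0 \<le> y" "2 * y < p"
proof -
  define I where "I = {0..(p - 1) div 2}"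
  define f g where "f = (\<lambda>x. x\<^sup>2 mod p)" and "g = (\<lambda>y. (- 1 - y\<^sup>2) mod p)"
  have p: "p > 2" using assms prime_ge_2_int[of p] by (cases "p = 2") auto
  have I: "0 \<le> x \<and> 2 * x < p" if "x \<in> I" for x
    using that p unfolding I_def by auto
  have eq: "x = y" if x: "x \<in> I" and y: "y \<in> I" and dvd: "p dvd x\<^sup>2 - y\<^sup>2" for x y
  proof -
    have "x\<^sup>2 - y\<^sup>2 = (x - y) * (x + y)" by (simp add: power2_eq_square algebra_simps)
    then consider "p dvd x - y" | "p dvd x + y"
      using dvd assms(1) by (auto simp: prime_dvd_mult_iff)
    then show ?thesis
    proof cases
      case 1
      then show ?thesis using I[OF x] I[OF y] zdvd_imp_le[of p "x - y"]
          zdvd_imp_le[of p "y - x"] by (cases x y rule: linorder_cases) (auto simp: dvd_diff_commute)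
    next
      case 2
      then show ?thesis using I[OF x] I[OF y] zdvd_imp_le[of p "x + y"]
        by (cases "x + y = 0") auto
    qed
  qed
  have inj: "inj_on f I" "inj_on g I"
    unfolding f_def g_def inj_on_def
    by (auto intro!: eq simp: mod_eq_dvd_iff) (metis dvd_diff_commute)
  have "f ` I \<inter> g ` I \<noteq> {}"
  proof
    assume "f ` I \<inter> g ` I = {}"
    then have "card (f ` I \<union> g ` I) = card I + card I"
      by (simp add: I_def card_Un_disjoint card_image[OF inj(1), unfolded I_def] card_image[OF inj(2), unfolded I_def])
    moreover have "f ` I \<union> g ` I \<subseteq> {0..<p}" using p by (auto simp: f_def g_def)
    then have "card (f ` I \<union> g ` I) \<le> card {0..<p}" by (intro card_mono) auto
    moreover have "int (card I) = (p + 1) div 2" using p by (simp add: I_def)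
    ultimately show False using p assms(2) by (auto elim!: oddE)
  qed
  then obtain x y where xy: "x \<in> I" "y \<in> I" "f x = g y" by auto
  have "p dvd x\<^sup>2 - (- 1 - y\<^sup>2)"
    using xy(3) by (simp only: f_def g_def mod_eq_dvd_iff)
  then have "p dvd x\<^sup>2 + y\<^sup>2 + 1" by (simp add: algebra_simps)
  then show ?thesis using that I xy by blast
qed

text \<open>Reduce the four roots to centered residues modulo \<open>m\<close>, whose squares add up
  to \<open>m * r\<close> with \<open>r \<le> m\<close>. Euler's identity for both quadruples yields
  four terms divisible by \<open>m\<close>; dividing by \<open>m\<^sup>2\<close> leaves
  \<open>r * p\<close>. Either of \<open>r = 0\<close> and \<open>r = m\<close> would force
  \<open>m * m dvd m * p\<close>, hence \<open>m dvd p\<close>.\<close>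

lemma four_squares_descent:
  fixes p m :: int
  assumes "prime p" "1 < m" "m < p" "sum_of_four_squares (m * p)"
  obtains r where "0 < r" "r < m" "sum_of_four_squares (r * p)"
proof -
  obtain x y z w where mp: "m * p = x\<^sup>2 + y\<^sup>2 + z\<^sup>2 + w\<^sup>2"
    using assms(4) unfolding sum_of_four_squares_def by blast
  have m0: "0 < m" using assms by simp
  have "\<not> m dvd p"
    using assms(1-3) m0 by (metis prime_int_iff less_irrefl less_imp_le)
  then have nsq: "\<not> m * m dvd m * p" using m0 by simp
  obtain a i where i: "x = a + m * i" and a: "2 * \<bar>a\<bar> \<le> m" using centered_residue[OF m0] .
  obtain b j where j: "y = b + m * j" and b: "2 * \<bar>b\<bar> \<le> m" using centered_residue[OF m0] .
  obtain c k where k: "z = c + m * k" and c: "2 * \<bar>c\<bar> \<le> m" using centered_residue[OF m0] .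
  obtain d l where l: "w = d + m * l" and d: "2 * \<bar>d\<bar> \<le> m" using centered_residue[OF m0] .
  \<comment> \<open>Found by expanding the four squares in \<open>m * p\<close> and solving for the
    sum of the squared residues.\<close>
  define r where "r = p - (2*a*i + 2*b*j + 2*c*k + 2*d*l + m*(i\<^sup>2 + j\<^sup>2 + k\<^sup>2 + l\<^sup>2))"
  have mr: "m * r = a\<^sup>2 + b\<^sup>2 + c\<^sup>2 + d\<^sup>2"
    using mp unfolding r_def i j k l by (simp add: power2_eq_square algebra_simps)
  have sq: "4 * t\<^sup>2 \<le> m\<^sup>2" if "2 * \<bar>t\<bar> \<le> m" for t
    using power_mono[OF that, of 2] by (simp add: power_mult_distrib)
  note sqs = sq[OF a] sq[OF b] sq[OF c] sq[OF d]
  have "r \<ge> 0" using mr m0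
    by (metis add_nonneg_nonneg zero_le_power2 zero_le_mult_iff not_less)
  moreover have "r \<noteq> 0"
  proof
    assume "r = 0"
    then have "a = 0 \<and> b = 0 \<and> c = 0 \<and> d = 0"
      using mr by (simp add: add_nonneg_eq_0_iff)
    then have "m * p = m * m * (i\<^sup>2 + j\<^sup>2 + k\<^sup>2 + l\<^sup>2)"
      using mp by (simp add: i j k l power2_eq_square algebra_simps)
    then show False using nsq by simp
  qed
  moreover have "r \<le> m"
    using sqs mr m0 by (intro mult_left_le_imp_le[of m r m]) (auto simp: power2_eq_square)
  moreover have "r \<noteq> m"
  proof
    assume "r = m"
    then have eqs: "4 * a\<^sup>2 = m\<^sup>2" "4 * b\<^sup>2 = m\<^sup>2" "4 * c\<^sup>2 = m\<^sup>2" "4 * d\<^sup>2 = m\<^sup>2"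
      using sqs mr by (auto simp: power2_eq_square)
    have half: "m dvd 2 * t" if "4 * t\<^sup>2 = m\<^sup>2" for t
    proof -
      have "(2 * t)\<^sup>2 = m\<^sup>2" using that by simp
      then show ?thesis by (simp only: power2_eq_iff) auto
    qed
    \<comment> \<open>All residues are now \<open>m / 2\<close> in absolute value, so the cross
      terms are multiples of \<open>m * m\<close> too.\<close>
    have "m * m dvd m * (2 * a * i + 2 * b * j + 2 * c * k + 2 * d * l)"
      using half[OF eqs(1)] half[OF eqs(2)] half[OF eqs(3)] half[OF eqs(4)]
      by (intro mult_dvd_mono dvd_refl dvd_add) auto
    moreover have "m * p = m * m * (1 + i\<^sup>2 + j\<^sup>2 + k\<^sup>2 + l\<^sup>2) +
        m * (2 * a * i + 2 * b * j + 2 * c * k + 2 * d * l)"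
      using mr \<open>r = m\<close> unfolding mp i j k l by (simp add: power2_eq_square algebra_simps)
    ultimately have "m * m dvd m * p" by (metis dvd_add dvd_triv_left)
    then show False using nsq by simp
  qed
  moreover have "sum_of_four_squares (r * p)"
  proof -
    \<comment> \<open>The terms of Euler's identity divided by \<open>m\<close>: the products of
      residues sum to \<open>m * r\<close> in the first and cancel in the others.\<close>
    define X Y Z W where "X = r + a*i + b*j + c*k + d*l"
      and "Y = i*b - j*a + k*d - l*c"
      and "Z = i*c - k*a + l*b - j*d"
      and "W = i*d - l*a + j*c - k*b"
    have "(m*p) * (m*r) = (m*X)\<^sup>2 + (m*Y)\<^sup>2 + (m*Z)\<^sup>2 + (m*W)\<^sup>2"
    proof -
      have "x*a + y*b + z*c + w*d = m*X" "x*b - y*a + z*d - w*c = m*Y"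
        "x*c - z*a + w*b - y*d = m*Z" "x*d - w*a + y*c - z*b = m*W"
        using mr unfolding X_def Y_def Z_def W_def i j k l by (simp_all add: power2_eq_square algebra_simps)
      then show ?thesis unfolding mp mr euler_four_square_identity by simp
    qed
    then have "m\<^sup>2 * (r * p) = m\<^sup>2 * (X\<^sup>2 + Y\<^sup>2 + Z\<^sup>2 + W\<^sup>2)" by (simp add: power2_eq_square algebra_simps)
    then have "r * p = X\<^sup>2 + Y\<^sup>2 + Z\<^sup>2 + W\<^sup>2" using m0 by simp
    then show ?thesis unfolding sum_of_four_squares_def by blast
  qed
  ultimately show ?thesis using that[of r] by simp
qed

text \<open>For odd \<open>p\<close>, some multiple
  \<open>m * p = x\<^sup>2 + y\<^sup>2 + 1\<^sup>2 + 0\<^sup>2\<close> with \<open>0 < m\<close> and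
  \<open>m < p\<close> starts the descent, which ends at \<open>m = 1\<close>.\<close>

lemma sum_of_four_squares_prime:
  fixes p :: int
  assumes "prime p"
  shows "sum_of_four_squares p"
proof (cases "p = 2")
  case True
  have "p = 1\<^sup>2 + 1\<^sup>2 + 0\<^sup>2 + 0\<^sup>2" using True by simp
  then show ?thesis unfolding sum_of_four_squares_def by blast
next
  case False
  then have p: "odd p" "p > 2"
    using assms prime_ge_2_int[of p] primes_dvd_imp_eq[of 2 p] by auto
  have descent: "sum_of_four_squares p"
    if "0 < m" "m < p" "sum_of_four_squares (m * p)" for m
    using that
  proof (induction "nat m" arbitrary: m rule: less_induct)
    case less
    show ?case
    proof (cases "m = 1")
      case True
      then show ?thesis using less.prems by simp
    next
      case False
      then obtain r where "0 < r" "r < m" "sum_of_four_squares (r * p)"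
        using four_squares_descent[OF assms, of m] less.prems by force
      then show ?thesis using less.hyps[of r] less.prems by simp
    qed
  qed
  obtain x y where xy: "p dvd x\<^sup>2 + y\<^sup>2 + 1" "0 \<le> x" "2 * x < p" "0 \<le> y" "2 * y < p"
    using prime_dvd_sum_two_squares_plus_one[OF assms p(1)] .
  then obtain m where m: "x\<^sup>2 + y\<^sup>2 + 1 = m * p" by (auto simp: mult.commute)
  \<comment> \<open>Each of \<open>4 * x\<^sup>2\<close>, \<open>4 * y\<^sup>2\<close> and 4 is
    below \<open>p\<^sup>2\<close>, so \<open>4 * m * p < 3 * p\<^sup>2\<close>.\<close>
  have "(2 * x)\<^sup>2 < p\<^sup>2" "(2 * y)\<^sup>2 < p\<^sup>2" using xy by (intro power_strict_mono; simp)+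
  moreover have "2 * 2 < p * p" using p by (intro mult_strict_mono) auto
  ultimately have "m * p < p * p" using m by (simp add: power2_eq_square)
  moreover have "0 < m * p" using m zero_le_power2[of x] zero_le_power2[of y] by linarith
  ultimately have "0 < m" "m < p" using p by (auto simp: zero_less_mult_iff)
  moreover have "m * p = x\<^sup>2 + y\<^sup>2 + 1\<^sup>2 + 0\<^sup>2" using m by simp
  ultimately show ?thesis using descent unfolding sum_of_four_squares_def by blast
qed

theorem lagrange_four_squares:
  fixes n :: nat
  shows "sum_of_four_squares (int n)"
proof (induction n rule: prime_divisors_induct)
  case zero
  have "int 0 = 0\<^sup>2 + 0\<^sup>2 + 0\<^sup>2 + 0\<^sup>2" by simp
  then show ?case unfolding sum_of_four_squares_def by blast
next
  case (unit n)
  then have "int n = 1\<^sup>2 + 0\<^sup>2 + 0\<^sup>2 + 0\<^sup>2" by simp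
  then show ?case unfolding sum_of_four_squares_def by blast
next
  case (factor p n)
  then show ?case by (simp add: sum_of_four_squares_mult sum_of_four_squares_prime)
qed

lemma four_squares_nonneg:
  fixes n :: int
  assumes "0 \<le> n"
  obtains w x y z where "n = w\<^sup>2 + x\<^sup>2 + y\<^sup>2 + z\<^sup>2" "0 \<le> w" "0 \<le> x" "0 \<le> y" "0 \<le> z"
proof -
  obtain w x y z where "n = w\<^sup>2 + x\<^sup>2 + y\<^sup>2 + z\<^sup>2"
    using lagrange_four_squares[of "nat n"] assms unfolding sum_of_four_squares_def by auto
  then show ?thesis using that[of "\<bar>w\<bar>" "\<bar>x\<bar>" "\<bar>y\<bar>" "\<bar>z\<bar>"] by simp
qed

section \<open>Splitting an integer into three products with small factors\<close>

lemma square_remainder: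
  fixes n :: int
  assumes "0 \<le> n"
  obtains q where "0 \<le> q" "q\<^sup>2 \<le> n" "n - q\<^sup>2 \<le> 2 * q"
proof -
  define q where "q = int (floor_sqrt (nat n))"
  have "int ((floor_sqrt (nat n))\<^sup>2) \<le> int (nat n)" by (simp only: of_nat_le_iff floor_sqrt_power2_le)
  moreover have "int (nat n) < int ((Suc (floor_sqrt (nat n)))\<^sup>2)"
    by (simp only: of_nat_less_iff Suc_floor_sqrt_power2_gt)
  ultimately have "q\<^sup>2 \<le> n" "n < (1 + q)\<^sup>2" using assms by (simp_all add: q_def)
  then show ?thesis using that[of q] by (simp add: q_def power2_eq_square algebra_simps)
qed

text \<open>With \<open>p = \<lfloor>\<surd>d\<rfloor>\<close>, \<open>q = \<lfloor>\<surd>(d - p\<^sup>2)\<rfloor>\<close> and \<open>r = d - p\<^sup>2 - q\<^sup>2\<close>, write \<open>d = p*p + q*q + r*1\<close>;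
  the bound on the squares comes down to \<open>(q - 2)\<^sup>2 * (q + 4) \<ge> 0\<close>.\<close>

lemma three_products:
  fixes d :: int
  assumes "0 \<le> d"
  obtains s1 s2 s3 t1 t2 t3 where
    "0 \<le> t1" "t1 \<le> s1" "0 \<le> t2" "t2 \<le> s2" "0 \<le> t3" "t3 \<le> s3"
    "s1 * t1 + s2 * t2 + s3 * t3 = d" "s1\<^sup>2 + s2\<^sup>2 + s3\<^sup>2 \<le> 2 * d"
proof -
  obtain p where p: "0 \<le> p" "p\<^sup>2 \<le> d" "d - p\<^sup>2 \<le> 2 * p" using square_remainder[OF assms] .
  obtain q where q: "0 \<le> q" "q\<^sup>2 \<le> d - p\<^sup>2" "d - p\<^sup>2 - q\<^sup>2 \<le> 2 * q"
    using square_remainder[of "d - p\<^sup>2"] p by auto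
  define r where "r = d - p\<^sup>2 - q\<^sup>2"
  have r: "0 \<le> r" "r \<le> 2 * q" using q by (simp_all add: r_def)
  \<comment> \<open>Equivalent to \<open>p\<^sup>2 + q\<^sup>2 + r\<^sup>2 \<le> 2 * d\<close>. If
    \<open>r \<ge> 1\<close>, then \<open>r \<le> 2 * q\<close> gives
    \<open>r\<^sup>2 - 2 * r \<le> 4 * q\<^sup>2 - 4 * q\<close>, so
    \<open>3 * q\<^sup>2 - 4 * q \<le> p\<^sup>2\<close> suffices.\<close>
  have "r\<^sup>2 \<le> 2 * r + p\<^sup>2 + q\<^sup>2"
  proof (cases "r = 0")
    case False
    have "q\<^sup>2 \<le> 2 * p" using p q by simp
    then have "(q\<^sup>2)\<^sup>2 \<le> (2 * p)\<^sup>2" by (intro power_mono) auto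
    moreover have "0 \<le> q * ((q - 2)\<^sup>2 * (q + 4))" using q by simp
    then have "12 * q\<^sup>2 - 16 * q \<le> (q\<^sup>2)\<^sup>2" by (simp add: power2_eq_square algebra_simps)
    ultimately have "3 * q\<^sup>2 - 4 * q \<le> p\<^sup>2" by (simp add: power_mult_distrib)
    moreover have "(r - 1)\<^sup>2 \<le> (2 * q - 1)\<^sup>2" using r False by (intro power_mono) auto
    ultimately show ?thesis by (simp add: power2_eq_square algebra_simps)
  qed simp
  \<comment> \<open>The last pair is \<open>s3 = r\<close> and \<open>t3 = 1\<close>, except that
    \<open>r = 0\<close> requires \<open>t3 = 0\<close> to keep \<open>t3 \<le> s3\<close>.\<close>
  then show ?thesis using p q r
    by (intro that[of p p q q "if r = 0 then 0 else 1" r])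
      (auto simp: r_def power2_eq_square)
qed

section \<open>Gram matrices of two nonnegative integer vectors\<close>

text \<open>The vectors are the rows of a factor with \<open>n\<close> columns; values at indices
  from \<open>n\<close> on are irrelevant.\<close>

definition gram_of_nonneg_vectors :: "nat \<Rightarrow> int \<Rightarrow> int \<Rightarrow> int \<Rightarrow> bool" where
  "gram_of_nonneg_vectors n a b c \<longleftrightarrow> (\<exists>x y :: nat \<Rightarrow> int.
     (\<forall>i<n. 0 \<le> x i \<and> 0 \<le> y i) \<and>
     (\<Sum>i<n. (x i)\<^sup>2) = a \<and> (\<Sum>i<n. x i * y i) = b \<and> (\<Sum>i<n. (y i)\<^sup>2) = c)"

lemma gram_of_nonneg_vectors_commute:
  "gram_of_nonneg_vectors n a b c \<Longrightarrow> gram_of_nonneg_vectors n c b a"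
  unfolding gram_of_nonneg_vectors_def by (metis (no_types, lifting) mult.commute sum.cong)

text \<open>Undoes a reduction step: adding \<open>x\<close> to the second vector keeps it
  nonnegative, whereas subtracting might not.\<close>

lemma gram_of_nonneg_vectors_shear:
  assumes "gram_of_nonneg_vectors n a (b - a) (c - 2 * b + a)"
  shows "gram_of_nonneg_vectors n a b c"
proof -
  obtain x y :: "nat \<Rightarrow> int" where xy: "\<forall>i<n. 0 \<le> x i \<and> 0 \<le> y i"
    "(\<Sum>i<n. (x i)\<^sup>2) = a" "(\<Sum>i<n. x i * y i) = b - a" "(\<Sum>i<n. (y i)\<^sup>2) = c - 2 * b + a"
    using assms unfolding gram_of_nonneg_vectors_def by blast
  have "(\<Sum>i<n. x i * (x i + y i)) = (\<Sum>i<n. (x i)\<^sup>2) + (\<Sum>i<n. x i * y i)"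
    by (simp add: distrib_left power2_eq_square sum.distrib)
  moreover have "(\<Sum>i<n. (x i + y i)\<^sup>2) =
      (\<Sum>i<n. (x i)\<^sup>2) + (\<Sum>i<n. (y i)\<^sup>2) + 2 * (\<Sum>i<n. x i * y i)"
    by (simp add: power2_sum sum.distrib sum_distrib_left mult.assoc)
  ultimately have "(\<Sum>i<n. x i * (x i + y i)) = b" "(\<Sum>i<n. (x i + y i)\<^sup>2) = c"
    using xy(2-4) by simp_all
  then show ?thesis using xy unfolding gram_of_nonneg_vectors_def
    by (intro exI[of _ x] exI[of _ "\<lambda>i. x i + y i"]) simp
qed

lemma sum_square_le_sum_mult:
  fixes s1 s2 s3 t1 t2 t3 :: int
  assumes "0 \<le> t1" "t1 \<le> s1" "0 \<le> t2" "t2 \<le> s2" "0 \<le> t3" "t3 \<le> s3"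
  shows "t1\<^sup>2 + t2\<^sup>2 + t3\<^sup>2 \<le> s1 * t1 + s2 * t2 + s3 * t3"
  using assms unfolding power2_eq_square by (intro add_mono mult_right_mono)

lemma gram_of_nonneg_vectors_list:
  assumes "length xs = n" "length ys = n" "\<forall>x\<in>set xs. 0 \<le> x" "\<forall>y\<in>set ys. 0 \<le> y"
  shows "gram_of_nonneg_vectors n (\<Sum>x\<leftarrow>xs. x\<^sup>2) (\<Sum>(x, y)\<leftarrow>zip xs ys. x * y) (\<Sum>y\<leftarrow>ys. y\<^sup>2)"
proof -
  have "\<forall>i<n. 0 \<le> xs ! i \<and> 0 \<le> ys ! i" using assms by auto
  then show ?thesis
    unfolding gram_of_nonneg_vectors_def using assms(1,2)
    by (intro exI conjI) (auto simp: sum_list_sum_nth lessThan_atLeast0)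
qed

lemma gram_of_nonneg_vectors_diagonally_dominant:
  assumes "0 \<le> b" "b \<le> a" "b \<le> c"
  shows "gram_of_nonneg_vectors 11 a b c"
proof -
  define d where "d = min b (a - b)"
  have d: "0 \<le> d" "2 * d \<le> a" using assms by (auto simp: d_def min_def)
  obtain s1 s2 s3 t1 t2 t3 where
    st: "0 \<le> t1" "t1 \<le> s1" "0 \<le> t2" "t2 \<le> s2" "0 \<le> t3" "t3 \<le> s3"
    and dot: "s1 * t1 + s2 * t2 + s3 * t3 = d" and s: "s1\<^sup>2 + s2\<^sup>2 + s3\<^sup>2 \<le> 2 * d"
    using three_products[OF d(1)] .
  have t: "t1\<^sup>2 + t2\<^sup>2 + t3\<^sup>2 \<le> d" using sum_square_le_sum_mult[OF st] dot by simp
  have "0 \<le> a - (s1\<^sup>2 + s2\<^sup>2 + s3\<^sup>2)" using s d by simp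
  then obtain w1 w2 w3 w4 where w: "a - (s1\<^sup>2 + s2\<^sup>2 + s3\<^sup>2) = w1\<^sup>2 + w2\<^sup>2 + w3\<^sup>2 + w4\<^sup>2"
    "0 \<le> w1" "0 \<le> w2" "0 \<le> w3" "0 \<le> w4"
    by (rule four_squares_nonneg)
  \<comment> \<open>The count 11 is 3 coordinates for \<open>s\<close>, 4 for \<open>w\<close>, and
    4 where only the second vector may be nonzero.\<close>
  let ?xs = "[s1, s2, s3, w1, w2, w3, w4, 0, 0, 0, 0]"
  show ?thesis
  proof (cases "2 * b \<le> a")
    case True
    then have "b = d" by (simp add: d_def)
    then have "0 \<le> c - (t1\<^sup>2 + t2\<^sup>2 + t3\<^sup>2)" using t assms by simp
    then obtain v1 v2 v3 v4 where v: "c - (t1\<^sup>2 + t2\<^sup>2 + t3\<^sup>2) = v1\<^sup>2 + v2\<^sup>2 + v3\<^sup>2 + v4\<^sup>2"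
      "0 \<le> v1" "0 \<le> v2" "0 \<le> v3" "0 \<le> v4"
      by (rule four_squares_nonneg)
    let ?ys = "[t1, t2, t3, 0, 0, 0, 0, v1, v2, v3, v4]"
    have "\<forall>x\<in>set ?xs. 0 \<le> x" "\<forall>y\<in>set ?ys. 0 \<le> y" using st w(2-) v(2-) by simp_all
    moreover have "(\<Sum>x\<leftarrow>?xs. x\<^sup>2) = a" "(\<Sum>y\<leftarrow>?ys. y\<^sup>2) = c" using w(1) v(1) by simp_all
    moreover have "(\<Sum>(x, y)\<leftarrow>zip ?xs ?ys. x * y) = b" using dot \<open>b = d\<close> by simp
    ultimately show ?thesis using gram_of_nonneg_vectors_list[of ?xs 11 ?ys] by simp
  next
    case False
    then have "d = a - b" by (simp add: d_def)
    define u1 u2 u3 where "u1 = s1 - t1" and "u2 = s2 - t2" and "u3 = s3 - t3"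
    have u: "0 \<le> u1" "0 \<le> u2" "0 \<le> u3" using st by (simp_all add: u1_def u2_def u3_def)
    \<comment> \<open>The squares of \<open>s\<close> and \<open>w\<close> add up to
      \<open>a\<close>, and replacing \<open>s\<close> by \<open>s - t\<close> in one factor removes
      \<open>d = a - b\<close>.\<close>
    have eq: "s1 * u1 + s2 * u2 + s3 * u3 + w1\<^sup>2 + w2\<^sup>2 + w3\<^sup>2 + w4\<^sup>2 = b"
      using dot w(1) \<open>d = a - b\<close> by (simp add: u1_def u2_def u3_def power2_eq_square algebra_simps)
    have "u1\<^sup>2 + u2\<^sup>2 + u3\<^sup>2 \<le> s1 * u1 + s2 * u2 + s3 * u3"
      using st by (intro sum_square_le_sum_mult) (simp_all add: u1_def u2_def u3_def)
    then have "0 \<le> c - (u1\<^sup>2 + u2\<^sup>2 + u3\<^sup>2 + w1\<^sup>2 + w2\<^sup>2 + w3\<^sup>2 + w4\<^sup>2)" using eq assms by simp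
    then obtain v1 v2 v3 v4 where v:
      "c - (u1\<^sup>2 + u2\<^sup>2 + u3\<^sup>2 + w1\<^sup>2 + w2\<^sup>2 + w3\<^sup>2 + w4\<^sup>2) = v1\<^sup>2 + v2\<^sup>2 + v3\<^sup>2 + v4\<^sup>2"
      "0 \<le> v1" "0 \<le> v2" "0 \<le> v3" "0 \<le> v4"
      by (rule four_squares_nonneg)
    let ?ys = "[u1, u2, u3, w1, w2, w3, w4, v1, v2, v3, v4]"
    have "\<forall>x\<in>set ?xs. 0 \<le> x" "\<forall>y\<in>set ?ys. 0 \<le> y" using st w(2-) v(2-) u by simp_all
    moreover have "(\<Sum>x\<leftarrow>?xs. x\<^sup>2) = a" "(\<Sum>y\<leftarrow>?ys. y\<^sup>2) = c" using w(1) v(1) by simp_all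
    moreover have "(\<Sum>(x, y)\<leftarrow>zip ?xs ?ys. x * y) = b" using eq by (simp add: power2_eq_square)
    ultimately show ?thesis using gram_of_nonneg_vectors_list[of ?xs 11 ?ys] by simp
  qed
qed

text \<open>Induction on the trace: if \<open>a < b\<close>, passing to \<open>a\<close>,
  \<open>b - a\<close>, \<open>c - 2 * b + a\<close> preserves the determinant and lowers the trace
  by \<open>2 * (b - a)\<close>.\<close>

lemma gram_of_nonneg_vectors_11:
  assumes "0 \<le> a" "0 \<le> b" "0 \<le> c" "b\<^sup>2 \<le> a * c"
  shows "gram_of_nonneg_vectors 11 a b c"
  using assms
proof (induction "nat (a + c)" arbitrary: a b c rule: less_induct)
  case less
  \<comment> \<open>Stated for \<open>a'\<close> and \<open>c'\<close> to serve both orders of the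
    diagonal entries.\<close>
  have *: ?case if "a' < b" "0 \<le> a'" "0 \<le> c'" "b\<^sup>2 \<le> a' * c'" "a' + c' = a + c"
    "gram_of_nonneg_vectors 11 a' b c' \<Longrightarrow> ?case" for a' c'
  proof -
    \<comment> \<open>The inequality of arithmetic and geometric means makes the new entry
      \<open>c' - 2 * b + a'\<close> nonnegative.\<close>
    have "0 \<le> (a' - c')\<^sup>2" by simp
    then have "(2 * b)\<^sup>2 \<le> (a' + c')\<^sup>2" using that(4) by (simp add: power2_eq_square algebra_simps)
    then have "2 * b \<le> a' + c'" using that(2,3) by (intro power2_le_imp_le[of "2 * b"]) simp_all
    moreover have "(b - a')\<^sup>2 \<le> a' * (c' - 2 * b + a')"
      using that(4) by (simp add: power2_eq_square algebra_simps)
    ultimately have "gram_of_nonneg_vectors 11 a' (b - a') (c' - 2 * b + a')"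
      using that(1,2,5) less.prems by (intro less.hyps) auto
    then show ?thesis using that(6) gram_of_nonneg_vectors_shear by blast
  qed
  consider "b \<le> a" "b \<le> c" | "a < b" | "c < b" by linarith
  then show ?case
  proof cases
    case 1
    then show ?thesis using gram_of_nonneg_vectors_diagonally_dominant less.prems by simp
  next
    case 2
    then show ?thesis using *[of a c] less.prems by simp
  next
    case 3
    show ?thesis
    proof (rule *[of c a])
      show "b\<^sup>2 \<le> c * a" using less.prems by (simp add: mult.commute)
    qed (use 3 less.prems gram_of_nonneg_vectors_commute in auto)
  qed
qed

section \<open>Passage between matrices and integer triples\<close>

lemma integer_cp_factorization_of_gram:
  assumes "gram_of_nonneg_vectors n a b c"
  obtains V where "dim_col V = n"
    "integer_cp_factorization
       (mat_of_rows_list 2 [[of_int a, of_int b], [of_int b, of_int c]]) V"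
proof -
  obtain x y :: "nat \<Rightarrow> int" where xy: "\<forall>i<n. 0 \<le> x i \<and> 0 \<le> y i"
    "(\<Sum>i<n. (x i)\<^sup>2) = a" "(\<Sum>i<n. x i * y i) = b" "(\<Sum>i<n. (y i)\<^sup>2) = c"
    using assms unfolding gram_of_nonneg_vectors_def by blast
  define V where "V = mat 2 n (\<lambda>(i, j). if i = 0 then real_of_int (x j) else real_of_int (y j))"
  have nat: "real_of_int k \<in> \<nat>" if "0 \<le> k" for k
    using that by (metis of_nat_in_Nats of_int_of_nat_eq nonneg_int_cases)
  have sums: "(\<Sum>i<n. real_of_int (x i) * of_int (x i)) = of_int a"
    "(\<Sum>i<n. real_of_int (x i) * of_int (y i)) = of_int b"
    "(\<Sum>i<n. real_of_int (y i) * of_int (x i)) = of_int b"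
    "(\<Sum>i<n. real_of_int (y i) * of_int (y i)) = of_int c"
    unfolding xy(2-4)[symmetric] by (simp_all add: power2_eq_square mult.commute)
  have "elements_mat V \<subseteq> \<nat>"
    using xy(1) by (auto simp: V_def nat)
  moreover have "mat_of_rows_list 2 [[of_int a, of_int b], [of_int b, of_int c]] = V * transpose_mat V"
  proof (rule eq_matI)
    fix i j assume "i < dim_row (V * transpose_mat V)" "j < dim_col (V * transpose_mat V)"
    then have "(i = 0 \<or> i = 1) \<and> (j = 0 \<or> j = 1)" by (auto simp: V_def)
    then show "mat_of_rows_list 2 [[real_of_int a, of_int b], [of_int b, of_int c]] $$ (i, j) =
        (V * transpose_mat V) $$ (i, j)"
      using sums by (auto simp: V_def mat_of_rows_list_def scalar_prod_def lessThan_atLeast0)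
  qed (auto simp: V_def mat_of_rows_list_def)
  ultimately have "integer_cp_factorization
      (mat_of_rows_list 2 [[of_int a, of_int b], [of_int b, of_int c]]) V"
    by (auto simp: integer_cp_factorization_def V_def mat_of_rows_list_def)
  then show ?thesis using that[of V] by (simp add: V_def)
qed

lemma elements_mat_two_by_two:
  "elements_mat (mat_of_rows_list 2 [[a, b], [c, d]]) = {a, b, c, d}"
  by (auto simp: mat_of_rows_list_def elements_mat_def numeral_2_eq_2)

lemma doubly_nonnegative_two_by_two:
  assumes "doubly_nonnegative (mat_of_rows_list 2 [[a, b], [b, c]])"
  shows "0 \<le> a" "0 \<le> b" "0 \<le> c" "b\<^sup>2 \<le> a * c"
proof -
  let ?A = "mat_of_rows_list 2 [[a, b], [b, c]]"
  show nn: "0 \<le> a" "0 \<le> b" "0 \<le> c"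
    using assms by (auto simp: doubly_nonnegative_def elements_mat_two_by_two)
  have quad: "0 \<le> a * u\<^sup>2 + 2 * b * u * v + c * v\<^sup>2" for u v
  proof -
    have "0 \<le> vec_of_list [u, v] \<bullet> (?A *\<^sub>v vec_of_list [u, v])"
      using assms by (auto simp: doubly_nonnegative_def positive_semidefinite_def
          mat_of_rows_list_def intro!: carrier_vecI)
    also have "\<dots> = a * u\<^sup>2 + 2 * b * u * v + c * v\<^sup>2"
      by (simp add: mat_of_rows_list_def scalar_prod_def vec_of_list_index numeral_2_eq_2
          power2_eq_square algebra_simps)
    finally show ?thesis .
  qed
  show "b\<^sup>2 \<le> a * c"
  proof (cases "a = 0")
    case True
    \<comment> \<open>With \<open>a = 0\<close> the form at this vector is
      \<open>- (c + 2) * b\<^sup>2\<close>, which forces \<open>b = 0\<close>.\<close>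
    have "(c + 2) * b\<^sup>2 \<le> 0"
      using quad[of "- (c + 1)" b] True by (simp add: power2_eq_square algebra_simps)
    then have "b\<^sup>2 \<le> 0" using nn by (auto simp: mult_le_0_iff)
    then show ?thesis using True by simp
  next
    case False
    \<comment> \<open>The form at \<open>(- b, a)\<close> is \<open>a\<close> times the
      determinant.\<close>
    have "0 \<le> a * (a * c - b\<^sup>2)" using quad[of "- b" a] by (simp add: power2_eq_square algebra_simps)
    then show ?thesis using False nn by (simp add: zero_le_mult_iff)
  qed
qed

theorem theorem2p2:
  fixes a b c :: real and A :: "real mat"
  assumes "A = mat_of_rows_list 2 [[a, b], [b, c]]"
    and "integer_doubly_nonnegative A"
  shows "has_integer_cp_factorization A \<and> integer_cp_rank A \<le> 11"
proof -
  have "a \<in> \<int>" "b \<in> \<int>" "c \<in> \<int>"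
    using assms by (auto simp: integer_doubly_nonnegative_def elements_mat_two_by_two)
  then obtain a' b' c' where abc: "a = of_int a'" "b = of_int b'" "c = of_int c'"
    by (auto elim!: Ints_cases)
  have "0 \<le> a" "0 \<le> b" "0 \<le> c" "b\<^sup>2 \<le> a * c"
    using assms by (auto simp: integer_doubly_nonnegative_def intro: doubly_nonnegative_two_by_two)
  then have "gram_of_nonneg_vectors 11 a' b' c'"
    by (intro gram_of_nonneg_vectors_11) (simp_all add: abc flip: of_int_power of_int_mult)
  then obtain V where "dim_col V = 11" "integer_cp_factorization A V"
    using integer_cp_factorization_of_gram assms(1) abc by metis
  then show ?thesis unfolding has_integer_cp_factorization_def integer_cp_rank_def
    by (blast intro: Least_le)
qed

end
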